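(* Let $V_0,\hat V_0,\tilde V_1,V_1$ be finite element spaces on $\Omega$, with recovery operator $\mathcal{R}:V_0\to\tilde V_1$, projection operator $\hat{\mathcal{P}}:\tilde V_1\to\hat V_0$, injection $\mathcal{I}$ into $V_1$, and final projection $\mathcal{P}:V_1\to V_0$ equal to either $\mathcal{P}_A$ or $\mathcal{P}_B$, all as described in the context. Suppose there is some $C>0$ such that $\|\mathcal{R}\rho_0\|\le C\|\rho_0\|$ for all $\rho_0\in V_0$. Let the advection operator $\mathcal{A}:V_1\to V_1$ have a stability constant $\alpha$, such that $$\|\mathcal{A}\|:=\sup_{\rho_1\in V_1,\ \|\rho_1\|>0}\frac{\|\mathcal{A}\rho_1\|}{\|\rho_1\|}\le\alpha .$$ Then the `recovered space' scheme $\rho_0^{n+1}=\mathcal{P}\mathcal{A}\mathcal{I}(\mathcal{R}-\hat{\mathcal{P}}\mathcal{R}+1)\rho_0^n$ on $V_0$ has stability constant $\alpha^*=\kappa\alpha$ for some constant $\kappa$ (not depending on $\mathcal{A}$ or $\alpha$); that is, $$\sup_{\rho_0\in V_0,\ \|\rho_0\|>0}\frac{\|\mathcal{P}\mathcal{A}\mathcal{I}(\mathcal{R}-\hat{\mathcal{P}}\mathcal{R}+1)\rho_0\|}{\|\rho_0\|}\le\kappa\alpha .$$ Here $\|\cdot\|$ denotes the $L^2(\Omega)$ norm.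
   Context: $\Omega$ is the spatial domain with a mesh. $V_0=V_0(\Omega)$ is the lowest-order finite element space in which the initial field lies. $V_1=V_1(\Omega)$ is the space of next degree, fully discontinuous between elements, with $V_0\subset V_1$. $\tilde V_1\subset V_1$ is the fully continuous space of the same degree as $V_1$. $\hat V_0\subset V_1$ is the broken (fully discontinuous) version of $V_0$, so $V_0\subset\hat V_0$ (the two may coincide). All are finite-dimensional subspaces of $L^2(\Omega)$, with the usual degrees of freedom (DOFs). Recovery operator: $\mathcal{R}:V_0\to\tilde V_1$ maps a function in the initial space to one in the continuous higher-degree space (with second-order numerical accuracy as the mesh is refined). Projection operator $\hat{\mathcal{P}}:\tilde V_1\to\hat V_0$: for $\tilde v\in\tilde V_1$, $\hat u=\hat{\mathcal{P}}\tilde v\in\hat V_0$ is the solution of $\int_\Omega\hat\psi\,\hat u\,\mathrm{d}x=\int_\Omega\hat\psi\,\tilde v\,\mathrm{d}x$ for all $\hat\psi\in\hat V_0$. Injection operator $\mathcal{I}$: identifies a function in $V_0$, $\hat V_0$ or $\tilde V_1$ (or a sum of such functions) as a member of $V_1$; it is mathematically the inclusion map. The symbol $1$ denotes the identity. Advection operator $\mathcal{A}:V_1\to V_1$: represents performing one time step of a stable discretisation of the advection equation (with second-order numerical accuracy in space as the mesh is refined). Final projection $\mathcal{P}:V_1\to V_0$, one of two forms: - $\mathcal{P}_A$: for $v\in V_1$, $u=\mathcal{P}_Av\in V_0$ is the solution of $\int_\Omega\psi\,u\,\mathrm{d}x=\int_\Omega\psi\,v\,\mathrm{d}x$ for all $\psi\in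 V_0$. - $\mathcal{P}_B=\mathcal{P}_R\mathcal{P}_I$, where $\mathcal{P}_I:V_1\to\hat V_0$ is interpolation into the broken space by (elementwise) pointwise evaluation at the DOFs of $\hat V_0$, and $\mathcal{P}_R:\hat V_0\to V_0$ restores continuity by averaging: the value of $\mathcal{P}_R\hat u$ at each DOF of $V_0$ is the arithmetic mean, over the elements sharing that DOF, of the values of $\hat u$ at the corresponding DOFs of those elements. A "stability constant" of an operator is an upper bound for its operator norm with respect to the $L^2$ norm. *)

theory Defs
  imports
    "HOL-Analysis.Analysis"
    "HOL-Library.Disjoint_Sets"
    "HOL-Library.Extended_Real"
    "HOL-Library.FuncSet"
begin

(* The elements are closed; their interiors fill \<Omega> up to a null set. *)
definition mesh :: "'a::euclidean_space set \<Rightarrow> 'a set set \<Rightarrow> bool" where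
  "mesh \<Omega> \<T> \<longleftrightarrow>
     open \<Omega> \<and> \<Omega> \<noteq> {} \<and> finite \<T> \<and> closure \<Omega> = \<Union>\<T> \<and>
     (\<forall>K\<in>\<T>. compact K \<and> K \<noteq> {} \<and> closure (interior K) = K \<and>
        negligible (frontier K) \<and> interior K \<subseteq> \<Omega>) \<and>
     (\<forall>K\<in>\<T>. \<forall>L\<in>\<T>. K \<noteq> L \<longrightarrow> interior K \<inter> interior L = {})"

definition shape_space :: "'a::euclidean_space set \<Rightarrow> ('a \<Rightarrow> real) set \<Rightarrow> bool" where
  "shape_space K P \<longleftrightarrow>
     (\<exists>B. finite B \<and> P = range (\<lambda>c x. \<Sum>b\<in>B. c b * b x)) \<and>
     (\<forall>p\<in>P. continuous_on K p)"

(* Ciarlet triple (K, P, N) whose degrees of freedom are the point evaluations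
   at the nodes N; the last two conjuncts are unisolvence. *)
definition lagrange_element ::
  "'a::euclidean_space set \<Rightarrow> ('a \<Rightarrow> real) set \<Rightarrow> 'a set \<Rightarrow> bool" where
  "lagrange_element K P N \<longleftrightarrow>
     shape_space K P \<and> finite N \<and> N \<subseteq> K \<and>
     (\<forall>y. \<exists>p\<in>P. \<forall>x\<in>N. p x = y x) \<and>
     (\<forall>p\<in>P. \<forall>q\<in>P. (\<forall>x\<in>N. p x = q x) \<longrightarrow> (\<forall>x\<in>K. p x = q x))"

(* Members of L^2 are represented by functions defined pointwise.  A function that
   is discontinuous between elements has no canonical value on the mesh skeleton,
   which is a null set; the representative chosen vanishes there (and outside
   \<Omega>).  With this normalisation two members of a finite element space
   are equal iff they are equal almost everywhere. *)
definition broken_space ::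
  "'a::euclidean_space set set \<Rightarrow> ('a set \<Rightarrow> ('a \<Rightarrow> real) set) \<Rightarrow> ('a \<Rightarrow> real) set" where
  "broken_space \<T> S =
     {v. (\<forall>K\<in>\<T>. \<exists>p\<in>S K. \<forall>x\<in>interior K. v x = p x) \<and>
         (\<forall>x. x \<notin> (\<Union>K\<in>\<T>. interior K) \<longrightarrow> v x = 0)}"

(* Continuity has to be stated up to the skeleton values, which are normalised to 0. *)
definition continuous_subspace ::
  "'a::euclidean_space set \<Rightarrow> 'a set set \<Rightarrow> ('a \<Rightarrow> real) set \<Rightarrow> ('a \<Rightarrow> real) set" where
  "continuous_subspace \<Omega> \<T> V =
     {v\<in>V. \<exists>g. continuous_on \<Omega> g \<and> (\<forall>K\<in>\<T>. \<forall>x\<in>interior K. v x = g x)}"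

(* The value at a point x of the closed element K, taken from within K. *)
definition elem_value :: "'a::euclidean_space set \<Rightarrow> ('a \<Rightarrow> real) \<Rightarrow> 'a \<Rightarrow> real" where
  "elem_value K v x = Lim (at x within interior K) v"

(* A local degree of freedom is a pair (K, x) with x a node of K.  A global degree of
   freedom of the conforming space is the set of local ones identified with each
   other, all at one point, hence at most one per element.  Coincident nodes need not
   be identified: a space may be continuous in some directions only, and in the
   extreme case of singleton blocks it coincides with its broken version. *)
definition dof_identification ::
  "'a::euclidean_space set set \<Rightarrow> ('a set \<Rightarrow> 'a set) \<Rightarrow> ('a set \<times> 'a) set set \<Rightarrow> bool" where
  "dof_identification \<T> N D \<longleftrightarrow>
     partition_on (Sigma \<T> N) D \<and> (\<forall>\<sigma>\<in>D. \<exists>x. snd ` \<sigma> = {x})"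

definition conforming_space ::
  "'a::euclidean_space set set \<Rightarrow> ('a set \<Rightarrow> ('a \<Rightarrow> real) set) \<Rightarrow> ('a set \<times> 'a) set set
     \<Rightarrow> ('a \<Rightarrow> real) set" where
  "conforming_space \<T> S D =
     {u\<in>broken_space \<T> S. \<forall>\<sigma>\<in>D. \<forall>(K, x)\<in>\<sigma>. \<forall>(L, y)\<in>\<sigma>. elem_value K u x = elem_value L u y}"

definition l2_inner :: "'a::euclidean_space set \<Rightarrow> ('a \<Rightarrow> real) \<Rightarrow> ('a \<Rightarrow> real) \<Rightarrow> real" where
  "l2_inner \<Omega> f g = (LINT x|lebesgue_on \<Omega>. f x * g x)"

definition l2_norm :: "'a::euclidean_space set \<Rightarrow> ('a \<Rightarrow> real) \<Rightarrow> real" where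
  "l2_norm \<Omega> f = sqrt (LINT x|lebesgue_on \<Omega>. (f x)\<^sup>2)"

definition l2_projection ::
  "'a::euclidean_space set \<Rightarrow> ('a \<Rightarrow> real) set \<Rightarrow> ('a \<Rightarrow> real) \<Rightarrow> ('a \<Rightarrow> real)" where
  "l2_projection \<Omega> V v = (THE u. u \<in> V \<and> (\<forall>\<psi>\<in>V. l2_inner \<Omega> \<psi> u = l2_inner \<Omega> \<psi> v))"

definition nodal_interpolation ::
  "'a::euclidean_space set set \<Rightarrow> ('a set \<Rightarrow> 'a set) \<Rightarrow> ('a \<Rightarrow> real) set
     \<Rightarrow> ('a \<Rightarrow> real) \<Rightarrow> ('a \<Rightarrow> real)" where
  "nodal_interpolation \<T> N V v =
     (THE u. u \<in> V \<and> (\<forall>K\<in>\<T>. \<forall>x\<in>N K. elem_value K u x = elem_value K v x))"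

definition dof_averaging ::
  "('a::euclidean_space set \<times> 'a) set set \<Rightarrow> ('a \<Rightarrow> real) set
     \<Rightarrow> ('a \<Rightarrow> real) \<Rightarrow> ('a \<Rightarrow> real)" where
  "dof_averaging D V v =
     (THE u. u \<in> V \<and> (\<forall>\<sigma>\<in>D. \<forall>(K, x)\<in>\<sigma>.
        elem_value K u x = (\<Sum>(L, y)\<in>\<sigma>. elem_value L v y) / real (card \<sigma>)))"

(* Valued in ereal because the supremum of an unbounded set of reals is unspecified. *)
definition l2_opnorm ::
  "'a::euclidean_space set \<Rightarrow> ('a \<Rightarrow> real) set \<Rightarrow> (('a \<Rightarrow> real) \<Rightarrow> ('a \<Rightarrow> real)) \<Rightarrow> ereal" where
  "l2_opnorm \<Omega> V F =
     (SUP \<rho>\<in>{\<rho>\<in>V. l2_norm \<Omega> \<rho> > 0}. ereal (l2_norm \<Omega> (F \<rho>) / l2_norm \<Omega> \<rho>))"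

(* The injection into the larger space is the inclusion of sets of functions, so it
   leaves no trace in the formula. *)
definition recovered_step ::
  "(('a \<Rightarrow> real) \<Rightarrow> ('a \<Rightarrow> real)) \<Rightarrow> (('a \<Rightarrow> real) \<Rightarrow> ('a \<Rightarrow> real)) \<Rightarrow>
   (('a \<Rightarrow> real) \<Rightarrow> ('a \<Rightarrow> real)) \<Rightarrow> (('a \<Rightarrow> real) \<Rightarrow> ('a \<Rightarrow> real)) \<Rightarrow>
   ('a \<Rightarrow> real) \<Rightarrow> ('a \<Rightarrow> real)" where
  "recovered_step P A Phat R \<rho> = P (A (\<lambda>x. R \<rho> x - Phat (R \<rho>) x + \<rho> x))"

end

theory Submission
  imports Defs "HOL-Library.Function_Algebras"
begin

text \<open>
  Both forms of the final projection \<open>P\<close>, and the projection \<open>Q\<close> onto the broken space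
  \<open>V0hat\<close>, are linear maps on the space \<open>V1\<close>. The \<open>L\<^sup>2\<close> inner product is definite on
  \<open>V1\<close>, because its members are continuous inside every element, and \<open>V1\<close> has finite
  dimension. A linear map on a finite-dimensional inner product space is bounded, so
  \<open>\<parallel>P v\<parallel> \<le> CP \<parallel>v\<parallel>\<close> and \<open>\<parallel>Q v\<parallel> \<le> CQ \<parallel>v\<parallel>\<close> on \<open>V1\<close> with constants that depend on the
  spaces only. With \<open>\<parallel>R \<rho>\<parallel> \<le> C \<parallel>\<rho>\<parallel>\<close> the triangle inequality bounds
  \<open>w = R \<rho> - Q (R \<rho>) + \<rho>\<close> by \<open>(C + CQ C + 1) \<parallel>\<rho>\<parallel>\<close>, and the scheme is
  \<open>P (A w)\<close>, which gives the constant \<open>\<kappa> = CP (C + CQ C + 1)\<close>.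

  The advection operator is an arbitrary map, and its operator norm says nothing about its
  value at zero. Hence \<open>w\<close> has to be nonzero when \<open>\<rho>\<close> is. It is: if \<open>w = 0\<close> then
  \<open>R \<rho> = Q (R \<rho>) - \<rho>\<close> lies in \<open>V0hat\<close>, so it is fixed by \<open>Q\<close>, and \<open>\<rho> = 0\<close> follows.

  The work lies in showing that the operators, which are described implicitly as the unique
  solutions of linear conditions, are well defined and linear on \<open>V1\<close>
  (\<open>linear_between_projection\<close>, \<open>linear_nodal_interpolation\<close>, \<open>linear_dof_averaging\<close>).
  For the orthogonal projections this comes from Gram--Schmidt, and for interpolation and
  averaging from the unisolvence of the elements. Boundedness is \<open>linear_bounded\<close>.
\<close>

section \<open>Finite-dimensional inner product spaces\<close>

text \<open>Linearity is asked for on \<open>U\<close> only: a projection described as the solution of a linear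
  system is unspecified where that system has no unique solution.\<close>

definition linear_between ::
  "'v::real_vector set \<Rightarrow> 'w::real_vector set \<Rightarrow> ('v \<Rightarrow> 'w) \<Rightarrow> bool" where
  "linear_between U W T \<longleftrightarrow> T \<in> U \<rightarrow> W \<and>
     (\<forall>u\<in>U. \<forall>v\<in>U. T (u + v) = T u + T v) \<and> (\<forall>c. \<forall>u\<in>U. T (c *\<^sub>R u) = c *\<^sub>R T u)"

lemma linear_between_comp:
  assumes "linear_between U V S" and "linear_between V W T"
  shows "linear_between U W (T \<circ> S)"
  using assms unfolding linear_between_def by (auto simp: Pi_iff)

lemma linear_between_mono:
  assumes "linear_between U V T" and "V \<subseteq> W"
  shows "linear_between U W T"
  using assms unfolding linear_between_def by auto

text \<open>A linear relation that is the graph of a function defines a linear map: the sum of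
  solutions solves the problem for the sum of the data, and uniqueness identifies it. All the
  projections of the scheme have this form.\<close>

lemma linear_between_The:
  assumes U: "subspace U"
    and ex1: "\<And>v. v \<in> U \<Longrightarrow> \<exists>!u. u \<in> W \<and> Q v u"
    and add: "\<And>v v' u u'. \<lbrakk>v \<in> U; v' \<in> U; u \<in> W; u' \<in> W; Q v u; Q v' u'\<rbrakk>
                \<Longrightarrow> u + u' \<in> W \<and> Q (v + v') (u + u')"
    and scale: "\<And>v u c. \<lbrakk>v \<in> U; u \<in> W; Q v u\<rbrakk> \<Longrightarrow> c *\<^sub>R u \<in> W \<and> Q (c *\<^sub>R v) (c *\<^sub>R u)"
  shows "linear_between U W (\<lambda>v. THE u. u \<in> W \<and> Q v u)"
proof -
  let ?T = "\<lambda>v. THE u. u \<in> W \<and> Q v u"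
  have T: "?T v \<in> W \<and> Q v (?T v)" if "v \<in> U" for v
    by (rule theI') (rule ex1[OF that])
  have eq: "?T v = u" if "v \<in> U" "u \<in> W \<and> Q v u" for v u
    by (rule the1_equality) (use ex1 that in auto)
  show ?thesis
    unfolding linear_between_def
  proof (intro conjI ballI allI)
    show "?T \<in> U \<rightarrow> W" using T by auto
    show "?T (v + v') = ?T v + ?T v'" if "v \<in> U" "v' \<in> U" for v v'
      using T[OF that(1)] T[OF that(2)] add[OF that] eq subspace_add[OF U that] by auto
    show "?T (c *\<^sub>R v) = c *\<^sub>R ?T v" if "v \<in> U" for c v
      using T[OF that] scale[OF that] eq subspace_scale[OF U that] by auto
  qed
qed

text \<open>The inner product lives on a subspace of the ambient space because the \<open>L\<^sup>2\<close> inner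
  product is bilinear and definite only on suitable functions.\<close>

locale finite_dim_inner_product =
  fixes V :: "'v::real_vector set" and ip :: "'v \<Rightarrow> 'v \<Rightarrow> real"
  assumes subspace: "subspace V"
    and finite_dim: "\<exists>G. finite G \<and> V \<subseteq> span G"
    and ip_add: "\<lbrakk>u \<in> V; v \<in> V; w \<in> V\<rbrakk> \<Longrightarrow> ip (u + v) w = ip u w + ip v w"
    and ip_scale: "\<lbrakk>u \<in> V; w \<in> V\<rbrakk> \<Longrightarrow> ip (c *\<^sub>R u) w = c * ip u w"
    and ip_commute: "\<lbrakk>u \<in> V; w \<in> V\<rbrakk> \<Longrightarrow> ip u w = ip w u"
    and ip_pos: "\<lbrakk>u \<in> V; u \<noteq> 0\<rbrakk> \<Longrightarrow> ip u u > 0"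
begin

definition nrm :: "'v \<Rightarrow> real" where "nrm v = sqrt (ip v v)"

lemmas in_V = subspace_add[OF subspace] subspace_scale[OF subspace] subspace_diff[OF subspace]
  subspace_0[OF subspace]

lemma ip_add_right: "\<lbrakk>u \<in> V; v \<in> V; w \<in> V\<rbrakk> \<Longrightarrow> ip w (u + v) = ip w u + ip w v"
  by (metis ip_add ip_commute in_V(1))

lemma ip_scale_right: "\<lbrakk>u \<in> V; w \<in> V\<rbrakk> \<Longrightarrow> ip w (c *\<^sub>R u) = c * ip w u"
  by (metis ip_scale ip_commute in_V(2))

lemma ip_diff_right: "\<lbrakk>u \<in> V; v \<in> V; w \<in> V\<rbrakk> \<Longrightarrow> ip w (u - v) = ip w u - ip w v"
  by (metis add_diff_cancel eq_diff_eq ip_add_right in_V(3))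

lemma ip_zero_right: "w \<in> V \<Longrightarrow> ip w 0 = 0"
  using ip_scale_right[of 0 w 0] in_V(4) by simp

lemma ip_nonneg: "u \<in> V \<Longrightarrow> ip u u \<ge> 0"
  using ip_pos[of u] ip_zero_right[of u] by (cases "u = 0") auto

lemma ip_square_add:
  "\<lbrakk>u \<in> V; v \<in> V\<rbrakk> \<Longrightarrow> ip (u + v) (u + v) = ip u u + 2 * ip u v + ip v v"
  using ip_commute[of v u] by (simp add: ip_add ip_add_right in_V)

lemma nrm_scale: "u \<in> V \<Longrightarrow> nrm (c *\<^sub>R u) = \<bar>c\<bar> * nrm u"
  by (simp add: nrm_def ip_scale ip_scale_right in_V real_sqrt_mult flip: mult.assoc)

lemma nrm_nonneg: "u \<in> V \<Longrightarrow> nrm u \<ge> 0"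
  by (simp add: nrm_def ip_nonneg)

lemma nrm_pos: "u \<in> V \<Longrightarrow> u \<noteq> 0 \<Longrightarrow> nrm u > 0"
  by (simp add: nrm_def ip_pos)

lemma Cauchy_Schwarz:
  assumes "u \<in> V" "v \<in> V"
  shows "ip u v \<le> nrm u * nrm v"
proof (cases "v = 0")
  case True
  then show ?thesis using assms ip_zero_right by (simp add: nrm_def)
next
  case False
  define c where "c = ip u v / ip v v"
  have pos: "ip v v > 0" using ip_pos assms False by auto
  have "0 \<le> ip (u + (-c) *\<^sub>R v) (u + (-c) *\<^sub>R v)"
    by (intro ip_nonneg in_V assms)
  also have "\<dots> = ip u u - 2 * c * ip u v + c * c * ip v v"
    using assms by (simp only: ip_square_add in_V ip_scale ip_scale_right)
  also have "\<dots> = ip u u - (ip u v)\<^sup>2 / ip v v"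
    using pos by (simp add: c_def field_simps power2_eq_square)
  finally have "(ip u v)\<^sup>2 \<le> ip u u * ip v v" using pos by (simp add: field_simps)
  then show ?thesis
    unfolding nrm_def real_sqrt_mult[symmetric] by (rule real_le_rsqrt)
qed

lemma nrm_triangle:
  assumes "u \<in> V" "v \<in> V"
  shows "nrm (u + v) \<le> nrm u + nrm v"
proof -
  have "ip (u + v) (u + v) \<le> (nrm u + nrm v)\<^sup>2"
    using Cauchy_Schwarz[OF assms] ip_nonneg[OF assms(1)] ip_nonneg[OF assms(2)] assms
    by (simp add: ip_square_add power2_sum nrm_def)
  then show ?thesis
    using nrm_nonneg assms by (simp add: nrm_def[of "u + v"] real_le_lsqrt)
qed

lemma subspace_finite_span:
  assumes "subspace U" "U \<subseteq> V"
  obtains G where "finite G" "U = span G"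
proof -
  obtain F where F: "finite F" "V \<subseteq> span F" using finite_dim by auto
  obtain G where G: "G \<subseteq> U" "independent G" "U \<subseteq> span G"
    using maximal_independent_subset[of U] by auto
  have "finite G"
    using independent_span_bound[OF F(1) G(2)] F(2) G(1) assms(2) by auto
  moreover have "U = span G" using G span_minimal[OF G(1) assms(1)] by auto
  ultimately show thesis using that by auto
qed

text \<open>One step of Gram--Schmidt, with \<open>h = g - q\<close> for the orthogonal projection \<open>q\<close> of \<open>g\<close>
  onto \<open>span G\<close>. The projection enters as a hypothesis, so that the step can be used in the
  induction that proves that projections exist.\<close>

lemma Gram_Schmidt_step:
  assumes sub: "span (insert g G) \<subseteq> V"
    and q: "q \<in> span G" "\<And>\<psi>. \<psi> \<in> span G \<Longrightarrow> ip \<psi> q = ip \<psi> g"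
  shows "\<exists>h\<in>span (insert g G). (\<forall>\<psi>\<in>span G. ip \<psi> h = 0) \<and>
    (\<forall>v\<in>span (insert g G). \<exists>u\<in>span G. \<exists>c. v = u + c *\<^sub>R h)"
proof (rule bexI[of _ "g - q"], intro conjI ballI)
  have mono: "span G \<subseteq> span (insert g G)" by (intro span_mono) auto
  show "g - q \<in> span (insert g G)"
    using q(1) mono by (auto intro: span_diff span_base)
  show "ip \<psi> (g - q) = 0" if "\<psi> \<in> span G" for \<psi>
  proof -
    have "\<psi> \<in> V" "q \<in> V" "g \<in> V"
      using that q(1) mono sub span_base[of g "insert g G"] by auto
    then show ?thesis using q(2)[OF that] by (simp add: ip_diff_right)
  qed
  show "\<exists>u\<in>span G. \<exists>c. v = u + c *\<^sub>R (g - q)" if v: "v \<in> span (insert g G)" for v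
  proof -
    obtain c where c: "v - c *\<^sub>R g \<in> span G" using v[unfolded span_breakdown_eq] by auto
    have "v = (v - c *\<^sub>R g + c *\<^sub>R q) + c *\<^sub>R (g - q)"
      by (simp add: algebra_simps)
    then show ?thesis using c q(1) span_add span_scale by metis
  qed
qed

text \<open>Induction on the spanning set: if \<open>p\<close> is the projection of \<open>v\<close> onto \<open>span G\<close> and \<open>h\<close> the new
  orthogonal direction, the projection onto the larger span adds to \<open>p\<close> the component of \<open>v\<close>
  along \<open>h\<close>.\<close>

lemma span_projection_exists:
  assumes "finite G"
  shows "span G \<subseteq> V \<Longrightarrow> v \<in> V \<Longrightarrow> \<exists>p\<in>span G. \<forall>\<psi>\<in>span G. ip \<psi> p = ip \<psi> v"
  using assms
proof (induction G arbitrary: v rule: finite_induct)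
  case empty
  then show ?case
    by (metis ip_zero_right ip_commute in_V(4) singletonD singletonI span_empty)
next
  case (insert g G)
  have sub: "span G \<subseteq> V" using insert.prems span_mono[of G "insert g G"] by auto
  have gV: "g \<in> V" using insert.prems span_base[of g "insert g G"] by auto
  obtain q where q: "q \<in> span G" "\<And>\<psi>. \<psi> \<in> span G \<Longrightarrow> ip \<psi> q = ip \<psi> g"
    using insert.IH[OF sub gV] by auto
  obtain p where p: "p \<in> span G" "\<And>\<psi>. \<psi> \<in> span G \<Longrightarrow> ip \<psi> p = ip \<psi> v"
    using insert.IH[OF sub \<open>v \<in> V\<close>] by auto
  obtain h where h_span: "h \<in> span (insert g G)"
    and orth: "\<And>\<psi>. \<psi> \<in> span G \<Longrightarrow> ip \<psi> h = 0"
    and decomp: "\<And>\<psi>. \<psi> \<in> span (insert g G) \<Longrightarrow> \<exists>\<phi>\<in>span G. \<exists>c. \<psi> = \<phi> + c *\<^sub>R h"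
    using Gram_Schmidt_step[OF insert.prems(1) q] by blast
  have hV: "h \<in> V" using h_span insert.prems(1) by auto
  have p_span: "p \<in> span (insert g G)" using p span_mono[of G "insert g G"] by auto
  \<comment> \<open>For \<open>h = 0\<close> the quotient is \<open>0\<close>, which is then a legitimate coefficient.\<close>
  define c where "c = ip h v / ip h h"
  have ch: "c * ip h h = ip h v"
    using ip_pos[OF hV] ip_commute[OF hV \<open>v \<in> V\<close>] ip_zero_right[OF \<open>v \<in> V\<close>]
    by (cases "h = 0") (auto simp: c_def)
  show ?case
  proof (intro bexI ballI)
    show "p + c *\<^sub>R h \<in> span (insert g G)"
      using p_span h_span by (intro span_add span_scale)
    fix \<psi> assume "\<psi> \<in> span (insert g G)"
    from decomp[OF this] obtain \<phi> d where \<phi>: "\<phi> \<in> span G" "\<psi> = \<phi> + d *\<^sub>R h" by auto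
    have V: "\<phi> \<in> V" "p \<in> V" using \<phi> p sub by auto
    have "ip \<psi> (p + c *\<^sub>R h) = ip \<phi> p + d * (c * ip h h)"
      using V hV orth[OF \<phi>(1)] orth[OF p(1)] ip_commute[OF V(2) hV]
      by (simp add: \<phi>(2) ip_add ip_add_right ip_scale ip_scale_right in_V)
    also have "\<dots> = ip \<psi> v"
      using V hV \<open>v \<in> V\<close> p(2)[OF \<phi>(1)] by (simp add: ch \<phi>(2) ip_add ip_scale in_V)
    finally show "ip \<psi> (p + c *\<^sub>R h) = ip \<psi> v" .
  qed
qed

lemma projection_ex1:
  assumes U: "subspace U" "U \<subseteq> V" and v: "v \<in> V"
  shows "\<exists>!p. p \<in> U \<and> (\<forall>\<psi>\<in>U. ip \<psi> p = ip \<psi> v)"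
proof -
  obtain G where "finite G" "U = span G" using subspace_finite_span[OF U] .
  then obtain p where p: "p \<in> U" "\<forall>\<psi>\<in>U. ip \<psi> p = ip \<psi> v"
    using span_projection_exists[of G v] U v by auto
  moreover have "q = p" if q: "q \<in> U" "\<forall>\<psi>\<in>U. ip \<psi> q = ip \<psi> v" for q
  proof -
    have d: "q - p \<in> U" using subspace_diff[OF U(1)] p q by auto
    have "ip (q - p) (q - p) = 0"
      using p q d U(2) by (simp add: ip_diff_right subset_iff)
    then show ?thesis using ip_pos[of "q - p"] d U(2) by force
  qed
  ultimately show ?thesis by blast
qed

lemma linear_between_projection:
  assumes U: "subspace U" "U \<subseteq> V"
  shows "linear_between V U (\<lambda>v. THE p. p \<in> U \<and> (\<forall>\<psi>\<in>U. ip \<psi> p = ip \<psi> v))"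
proof (rule linear_between_The[OF subspace])
  show "\<exists>!p. p \<in> U \<and> (\<forall>\<psi>\<in>U. ip \<psi> p = ip \<psi> v)" if "v \<in> V" for v
    by (rule projection_ex1[OF U that])
  show "p + p' \<in> U \<and> (\<forall>\<psi>\<in>U. ip \<psi> (p + p') = ip \<psi> (v + v'))"
    if "v \<in> V" "v' \<in> V" "p \<in> U" "p' \<in> U" "\<forall>\<psi>\<in>U. ip \<psi> p = ip \<psi> v" "\<forall>\<psi>\<in>U. ip \<psi> p' = ip \<psi> v'"
    for v v' p p'
    using that U by (auto simp: ip_add_right subset_iff intro: subspace_add)
  show "c *\<^sub>R p \<in> U \<and> (\<forall>\<psi>\<in>U. ip \<psi> (c *\<^sub>R p) = ip \<psi> (c *\<^sub>R v))"
    if "v \<in> V" "p \<in> U" "\<forall>\<psi>\<in>U. ip \<psi> p = ip \<psi> v" for v p c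
    using that U by (auto simp: ip_scale_right subset_iff intro: subspace_scale)
qed

text \<open>In the orthogonal decomposition \<open>v = u + c h\<close>, Pythagoras bounds both \<open>\<parallel>u\<parallel>\<close> and
  \<open>\<bar>c\<bar> \<parallel>h\<parallel>\<close> by \<open>\<parallel>v\<parallel>\<close>, so that \<open>\<parallel>T h\<parallel> / \<parallel>h\<parallel>\<close> is all that a new direction adds to the
  constant.\<close>

lemma linear_bounded_on_span:
  assumes T: "linear_between V V T" and "finite G"
  shows "span G \<subseteq> V \<Longrightarrow> \<exists>C\<ge>0. \<forall>v\<in>span G. nrm (T v) \<le> C * nrm v"
  using \<open>finite G\<close>
proof (induction G rule: finite_induct)
  case empty
  have "T 0 = 0" using T in_V(4) unfolding linear_between_def by (metis scaleR_zero_left)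
  then show ?case using ip_zero_right[OF in_V(4)] by (auto simp: nrm_def)
next
  case (insert g G)
  have sub: "span G \<subseteq> V" using insert.prems span_mono[of G "insert g G"] by auto
  have gV: "g \<in> V" using insert.prems span_base[of g "insert g G"] by auto
  obtain C where C: "C \<ge> 0" "\<And>v. v \<in> span G \<Longrightarrow> nrm (T v) \<le> C * nrm v"
    using insert.IH[OF sub] by auto
  obtain q where q: "q \<in> span G" "\<And>\<psi>. \<psi> \<in> span G \<Longrightarrow> ip \<psi> q = ip \<psi> g"
    using span_projection_exists[OF insert.hyps(1) sub gV] by auto
  obtain h where h_span: "h \<in> span (insert g G)"
    and orth: "\<And>\<psi>. \<psi> \<in> span G \<Longrightarrow> ip \<psi> h = 0"
    and decomp: "\<And>v. v \<in> span (insert g G) \<Longrightarrow> \<exists>u\<in>span G. \<exists>c. v = u + c *\<^sub>R h"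
    using Gram_Schmidt_step[OF insert.prems q] by blast
  have hV: "h \<in> V" using h_span insert.prems by auto
  have TV: "T v \<in> V" if "v \<in> V" for v using T that by (auto simp: linear_between_def)
  \<comment> \<open>If \<open>h = 0\<close> the quotient is \<open>0\<close>, which is right since then \<open>T h = 0\<close>.\<close>
  define C' where "C' = C + nrm (T h) / nrm h"
  show ?case
  proof (intro exI[of _ C'] conjI ballI)
    show "C' \<ge> 0" using C nrm_nonneg[OF hV] nrm_nonneg[OF TV[OF hV]] by (simp add: C'_def)
    fix v assume "v \<in> span (insert g G)"
    from decomp[OF this] obtain u c where u: "u \<in> span G" and v: "v = u + c *\<^sub>R h" by auto
    then have uV: "u \<in> V" using sub by auto
    have Pyth: "ip v v = ip u u + c\<^sup>2 * ip h h"
      using orth[OF u] uV hV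
      by (simp add: v ip_square_add in_V ip_scale ip_scale_right power2_eq_square)
    have "nrm u \<le> nrm v"
      unfolding nrm_def Pyth using ip_nonneg[OF hV] by simp
    moreover have "\<bar>c\<bar> * nrm (T h) \<le> nrm (T h) / nrm h * nrm v"
    proof (cases "h = 0")
      case True
      have "T 0 = 0" using T in_V(4) unfolding linear_between_def by (metis scaleR_zero_left)
      then show ?thesis using True ip_zero_right[OF in_V(4)] by (simp add: nrm_def)
    next
      case False
      have "(\<bar>c\<bar> * nrm h)\<^sup>2 \<le> ip v v"
        using ip_nonneg[OF hV] ip_nonneg[OF uV] by (simp add: Pyth power_mult_distrib nrm_def)
      then have "\<bar>c\<bar> * nrm h \<le> nrm v" unfolding nrm_def[of v] by (rule real_le_rsqrt)
      then have "nrm (T h) * (\<bar>c\<bar> * nrm h) \<le> nrm (T h) * nrm v"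
        using nrm_nonneg[OF TV[OF hV]] by (rule mult_left_mono)
      then show ?thesis using nrm_pos[OF hV False] by (simp add: field_simps)
    qed
    moreover have "nrm (T v) \<le> nrm (T u) + \<bar>c\<bar> * nrm (T h)"
    proof -
      have "T v = T u + c *\<^sub>R T h"
        using T uV hV in_V(2)[OF hV] unfolding linear_between_def v by auto
      then show ?thesis
        using nrm_triangle[OF TV[OF uV] in_V(2)[OF TV[OF hV]]] nrm_scale[OF TV[OF hV]] by simp
    qed
    ultimately show "nrm (T v) \<le> C' * nrm v"
      using C(2)[OF u] mult_left_mono[OF \<open>nrm u \<le> nrm v\<close> C(1)]
      by (simp add: C'_def algebra_simps)
  qed
qed

lemma linear_bounded:
  assumes "linear_between V V T"
  obtains C where "C \<ge> 0" "\<And>v. v \<in> V \<Longrightarrow> nrm (T v) \<le> C * nrm v"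
proof -
  obtain G where "finite G" "V = span G" using subspace_finite_span[OF subspace] by auto
  then show thesis using that linear_bounded_on_span[OF assms, of G] by auto
qed

end

section \<open>Real functions as vectors, and shape spaces\<close>

instantiation "fun" :: (type, real_vector) real_vector
begin

definition scaleR_fun :: "real \<Rightarrow> ('a \<Rightarrow> 'b) \<Rightarrow> 'a \<Rightarrow> 'b" where
  "scaleR_fun c f = (\<lambda>x. c *\<^sub>R f x)"

instance
  by standard (simp_all add: scaleR_fun_def plus_fun_def scaleR_add_right scaleR_add_left)

end

lemma sum_fun_apply: "(\<Sum>i\<in>I. f i) x = (\<Sum>i\<in>I. f i x)"
  by (induction I rule: infinite_finite_induct) auto

lemma shape_space_eq_span:
  assumes "shape_space K P"
  obtains B where "finite B" "P = span B"
proof -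
  obtain B where B: "finite B" "P = range (\<lambda>c x. \<Sum>b\<in>B. c b * b x)"
    using assms unfolding shape_space_def by blast
  have "(\<Sum>b\<in>B. c b *\<^sub>R b) = (\<lambda>x. \<Sum>b\<in>B. c b * b x)" for c :: "('a \<Rightarrow> real) \<Rightarrow> real"
    by (simp add: fun_eq_iff sum_fun_apply scaleR_fun_def)
  then have "P = span B" using B by (simp add: span_finite)
  then show thesis using that B(1) by auto
qed

lemma shape_space_subspace: "shape_space K P \<Longrightarrow> subspace P"
  by (metis shape_space_eq_span subspace_span)

section \<open>Broken finite element spaces with the \<open>L\<^sup>2\<close> inner product\<close>

text \<open>The limit that defines the value at a point of the closed element is taken over the
  interior. It is determined because the interior is dense in the element and has no isolated
  points.\<close>

lemma elem_value_eq:
  assumes K: "closure (interior K) = K" and x: "x \<in> K" and p: "continuous_on K p"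
    and v: "\<And>y. y \<in> interior K \<Longrightarrow> v y = p y"
  shows "elem_value K v x = p x"
proof -
  have "x \<in> closure (interior K)" using K x by simp
  then have "x islimpt interior K"
    using interior_limit_point[of x "interior K"] by (auto simp: closure_def)
  then have nontriv: "at x within interior K \<noteq> bot"
    by (simp add: trivial_limit_within)
  have "(p \<longlongrightarrow> p x) (at x within K)" using p x by (auto simp: continuous_on_def)
  then have "(p \<longlongrightarrow> p x) (at x within interior K)"
    using interior_subset tendsto_within_subset by blast
  then have "(v \<longlongrightarrow> p x) (at x within interior K)"
    by (rule Lim_transform_eventually) (auto simp: eventually_at_filter v)
  then show ?thesis unfolding elem_value_def using nontriv by (rule tendsto_Lim[rotated])
qed

locale broken_finite_element_space =
  fixes \<Omega> :: "'a::euclidean_space set" and \<T> :: "'a set set"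
    and S :: "'a set \<Rightarrow> ('a \<Rightarrow> real) set"
  assumes mesh: "mesh \<Omega> \<T>" and shape: "K \<in> \<T> \<Longrightarrow> shape_space K (S K)"
begin

abbreviation "V \<equiv> broken_space \<T> S"

text \<open>Every member of the broken space is the sum over the elements of its shape functions,
  each extended by zero outside the interior of its element (\<open>shape_functions\<close>), and every such
  sum is a member (\<open>glued_in_V\<close>). Dimension, measurability and boundedness are read off
  from this form.\<close>

definition cut :: "'a set \<Rightarrow> ('a \<Rightarrow> real) \<Rightarrow> 'a \<Rightarrow> real" where
  "cut K p = (\<lambda>x. indicator (interior K) x * p x)"

lemma finite_mesh: "finite \<T>"
  using mesh by (simp add: mesh_def)

lemma element:
  assumes "K \<in> \<T>"
  shows "compact K" "closure (interior K) = K" "interior K \<subseteq> \<Omega>"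
  using mesh assms by (auto simp: mesh_def)

lemma sum_cut:
  assumes "K \<in> \<T>" "x \<in> interior K"
  shows "(\<Sum>L\<in>\<T>. cut L (p L) x) = p K x"
proof -
  have "x \<notin> interior L" if "L \<in> \<T> - {K}" for L
    using mesh assms that unfolding mesh_def by blast
  then have "(\<Sum>L\<in>\<T> - {K}. cut L (p L) x) = 0"
    by (intro sum.neutral) (auto simp: cut_def)
  then show ?thesis
    using assms by (simp add: sum.remove[OF finite_mesh assms(1)] cut_def)
qed

lemma sum_cut_eq_0:
  assumes "x \<notin> (\<Union>K\<in>\<T>. interior K)"
  shows "(\<Sum>L\<in>\<T>. cut L (p L) x) = 0"
  using assms by (intro sum.neutral) (auto simp: cut_def)

lemma shape_function:
  assumes "v \<in> V" "K \<in> \<T>"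
  shows "\<exists>p\<in>S K. \<forall>x\<in>interior K. v x = p x"
  using assms by (simp add: broken_space_def)

lemma vanishes_on_skeleton: "v \<in> V \<Longrightarrow> x \<notin> (\<Union>K\<in>\<T>. interior K) \<Longrightarrow> v x = 0"
  by (simp add: broken_space_def)

lemma V_I:
  assumes "\<And>K. K \<in> \<T> \<Longrightarrow> \<exists>p\<in>S K. \<forall>x\<in>interior K. v x = p x"
    and "\<And>x. x \<notin> (\<Union>K\<in>\<T>. interior K) \<Longrightarrow> v x = 0"
  shows "v \<in> V"
  using assms by (simp add: broken_space_def)

lemma glued_in_V:
  assumes "\<And>K. K \<in> \<T> \<Longrightarrow> p K \<in> S K"
  shows "(\<lambda>x. \<Sum>L\<in>\<T>. cut L (p L) x) \<in> V"
proof (rule V_I)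
  show "\<exists>q\<in>S K. \<forall>x\<in>interior K. (\<Sum>L\<in>\<T>. cut L (p L) x) = q x" if "K \<in> \<T>" for K
    using assms[OF that] sum_cut[OF that] by blast
qed (rule sum_cut_eq_0)

lemma shape_functions:
  assumes "v \<in> V"
  shows "\<exists>p. (\<forall>K\<in>\<T>. p K \<in> S K \<and> continuous_on K (p K) \<and> (\<forall>x\<in>interior K. v x = p K x)) \<and>
    v = (\<lambda>x. \<Sum>L\<in>\<T>. cut L (p L) x)"
proof -
  have "\<exists>p. \<forall>K\<in>\<T>. p K \<in> S K \<and> (\<forall>x\<in>interior K. v x = p K x)"
    using shape_function[OF assms] by (intro bchoice) blast
  then obtain p where p: "\<And>K. K \<in> \<T> \<Longrightarrow> p K \<in> S K"
    "\<And>K x. K \<in> \<T> \<Longrightarrow> x \<in> interior K \<Longrightarrow> v x = p K x"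
    by auto
  have "v x = (\<Sum>L\<in>\<T>. cut L (p L) x)" for x
  proof (cases "x \<in> (\<Union>K\<in>\<T>. interior K)")
    case True
    then obtain K where "K \<in> \<T>" "x \<in> interior K" by blast
    then show ?thesis using p(2) sum_cut by simp
  next
    case False
    then show ?thesis using sum_cut_eq_0 vanishes_on_skeleton[OF assms] by simp
  qed
  moreover have "continuous_on K (p K)" if "K \<in> \<T>" for K
    using shape[OF that] p(1)[OF that] by (simp add: shape_space_def)
  ultimately show ?thesis using p by auto
qed

lemma V_eqI:
  assumes "u \<in> V" "v \<in> V" "\<And>K x. K \<in> \<T> \<Longrightarrow> x \<in> interior K \<Longrightarrow> u x = v x"
  shows "u = v"
proof
  fix x show "u x = v x"
    using assms by (cases "x \<in> (\<Union>K\<in>\<T>. interior K)") (auto simp: broken_space_def)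
qed

lemma subspace_V: "subspace V"
proof (rule subspaceI)
  note S = shape_space_subspace[OF shape]
  show "0 \<in> V"
    by (rule V_I) (auto intro!: bexI[of _ 0] subspace_0[OF S])
  show "u + v \<in> V" if "u \<in> V" "v \<in> V" for u v
  proof (rule V_I)
    fix K assume K: "K \<in> \<T>"
    obtain p where p: "p \<in> S K" "\<And>x. x \<in> interior K \<Longrightarrow> u x = p x"
      using shape_function[OF \<open>u \<in> V\<close> K] by blast
    obtain q where q: "q \<in> S K" "\<And>x. x \<in> interior K \<Longrightarrow> v x = q x"
      using shape_function[OF \<open>v \<in> V\<close> K] by blast
    show "\<exists>p\<in>S K. \<forall>x\<in>interior K. (u + v) x = p x"
      by (rule bexI[OF _ subspace_add[OF S[OF K] p(1) q(1)]]) (simp add: p q)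
  qed (simp add: that vanishes_on_skeleton)
  show "c *\<^sub>R u \<in> V" if "u \<in> V" for c u
  proof (rule V_I)
    fix K assume K: "K \<in> \<T>"
    obtain p where p: "p \<in> S K" "\<And>x. x \<in> interior K \<Longrightarrow> u x = p x"
      using shape_function[OF \<open>u \<in> V\<close> K] by blast
    show "\<exists>p\<in>S K. \<forall>x\<in>interior K. (c *\<^sub>R u) x = p x"
      by (rule bexI[OF _ subspace_scale[OF S[OF K] p(1), of c]]) (simp add: p scaleR_fun_def)
  qed (simp add: that vanishes_on_skeleton scaleR_fun_def)
qed

text \<open>The spanning functions are the spanning functions of the shape spaces, cut off outside
  their elements.\<close>

lemma finite_dim_V: "\<exists>G. finite G \<and> V \<subseteq> span G"
proof -
  have "\<exists>B. finite B \<and> S K = span B" if "K \<in> \<T>" for K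
    using shape_space_eq_span[OF shape[OF that]] by metis
  then obtain B where B: "\<And>K. K \<in> \<T> \<Longrightarrow> finite (B K)" "\<And>K. K \<in> \<T> \<Longrightarrow> S K = span (B K)"
    by metis
  have lin: "linear (cut K)" for K
    by (rule linearI) (auto simp: cut_def fun_eq_iff scaleR_fun_def algebra_simps)
  let ?G = "\<Union>K\<in>\<T>. cut K ` B K"
  have "v \<in> span ?G" if "v \<in> V" for v
  proof -
    obtain p where p: "\<And>K. K \<in> \<T> \<Longrightarrow> p K \<in> S K" "v = (\<lambda>x. \<Sum>L\<in>\<T>. cut L (p L) x)"
      using shape_functions[OF \<open>v \<in> V\<close>] by blast
    have "cut L (p L) \<in> span ?G" if "L \<in> \<T>" for L
    proof -
      have "cut L (p L) \<in> span (cut L ` B L)"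
        using p(1)[OF that] B(2)[OF that] linear_span_image[OF lin] by auto
      then show ?thesis using span_mono[of "cut L ` B L" ?G] that by blast
    qed
    then have "(\<Sum>L\<in>\<T>. cut L (p L)) \<in> span ?G" by (intro span_sum) auto
    then show ?thesis unfolding p(2) by (simp add: sum_fun_apply[abs_def] fun_eq_iff)
  qed
  then show ?thesis using B(1) finite_mesh by (intro exI[of _ ?G]) auto
qed

lemma V_measurable_bounded:
  assumes "v \<in> V"
  shows "v \<in> borel_measurable (lebesgue_on \<Omega>)" and "\<exists>M. \<forall>x. \<bar>v x\<bar> \<le> M"
proof -
  obtain p where p: "\<And>K. K \<in> \<T> \<Longrightarrow> continuous_on K (p K)" "v = (\<lambda>x. \<Sum>L\<in>\<T>. cut L (p L) x)"
    using shape_functions[OF assms] by blast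
  have "cut K (p K) \<in> borel_measurable borel" if "K \<in> \<T>" for K
    using borel_measurable_continuous_on_indicator[of "interior K" "p K"]
      continuous_on_subset[OF p(1)[OF that] interior_subset]
    by (simp add: cut_def)
  then have "v \<in> borel_measurable borel" unfolding p(2) by (intro borel_measurable_sum) auto
  then show "v \<in> borel_measurable (lebesgue_on \<Omega>)"
    by (intro measurable_restrict_space1 measurable_completion) simp
  have "\<exists>m. \<forall>x. \<bar>cut K (p K) x\<bar> \<le> m" if K: "K \<in> \<T>" for K
  proof -
    have "bounded (p K ` K)"
      by (intro compact_imp_bounded compact_continuous_image p element K)
    then obtain m where "\<And>x. x \<in> K \<Longrightarrow> \<bar>p K x\<bar> \<le> m" unfolding bounded_iff by auto
    then have "\<bar>cut K (p K) x\<bar> \<le> max m 0" for x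
      using interior_subset[of K] by (auto simp: cut_def indicator_def max_def subset_iff) force+
    then show ?thesis by blast
  qed
  then obtain m where m: "\<And>K x. K \<in> \<T> \<Longrightarrow> \<bar>cut K (p K) x\<bar> \<le> m K" by metis
  have "\<bar>v x\<bar> \<le> sum m \<T>" for x
    unfolding p(2) using m by (intro order.trans[OF sum_abs] sum_mono) auto
  then show "\<exists>M. \<forall>x. \<bar>v x\<bar> \<le> M" by blast
qed

lemma lmeasurable_domain: "\<Omega> \<in> lmeasurable"
proof -
  have "open \<Omega>" using mesh by (simp add: mesh_def)
  have "compact (closure \<Omega>)"
    using mesh by (auto simp: mesh_def intro!: compact_Union)
  then have "bounded \<Omega>"
    using bounded_subset[OF compact_imp_bounded closure_subset] by blast
  then show ?thesis using \<open>open \<Omega>\<close> by (rule lmeasurable_open)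
qed

lemma integrable_product:
  assumes "u \<in> V" "v \<in> V"
  shows "integrable (lebesgue_on \<Omega>) (\<lambda>x. u x * v x)"
proof -
  obtain M where M: "\<And>x. \<bar>u x\<bar> \<le> M" using V_measurable_bounded assms by blast
  obtain M' where M': "\<And>x. \<bar>v x\<bar> \<le> M'" using V_measurable_bounded assms by blast
  interpret finite_measure "lebesgue_on \<Omega>"
    by (rule finite_measure_lebesgue_on[OF lmeasurable_domain])
  have "norm (u x * v x) \<le> M * M'" for x
    using mult_mono[OF M M', of x x] M[of x] by (simp add: abs_mult)
  then show ?thesis
    using V_measurable_bounded(1) assms
    by (intro integrable_const_bound[where B = "M * M'"] borel_measurable_times) auto
qed

lemma l2_norm_eq: "l2_norm \<Omega> v = sqrt (l2_inner \<Omega> v v)"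
  by (simp add: l2_norm_def l2_inner_def power2_eq_square)

text \<open>If the square integral of \<open>v\<close> vanishes, the points with \<open>v \<noteq> 0\<close> form a null set; inside an
  element they also form an open set, so there are none. On the skeleton the normalisation
  makes \<open>v\<close> vanish. This is why the norm is definite on functions and not merely on their
  classes.\<close>

lemma l2_inner_definite:
  assumes v: "v \<in> V" and 0: "l2_inner \<Omega> v v = 0"
  shows "v = 0"
proof -
  have "AE x in lebesgue_on \<Omega>. v x * v x = 0"
    using 0 integral_nonneg_eq_0_iff_AE[OF integrable_product[OF v v]]
    by (simp add: l2_inner_def)
  then have "AE x in lebesgue. x \<in> \<Omega> \<longrightarrow> v x = 0"
    using lmeasurable_domain by (subst (asm) AE_restrict_space_iff) (auto simp: fmeasurableD)
  then obtain Z where Z: "Z \<in> null_sets lebesgue" "\<And>x. x \<notin> Z \<Longrightarrow> x \<in> \<Omega> \<Longrightarrow> v x = 0"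
    by (rule AE_E3) auto
  have ae: "negligible {x \<in> \<Omega>. v x \<noteq> 0}"
    by (rule negligible_subset[of Z]) (use Z in \<open>auto simp: negligible_iff_null_sets\<close>)
  obtain p where p: "\<And>K. K \<in> \<T> \<Longrightarrow> continuous_on K (p K)"
    "\<And>K x. K \<in> \<T> \<Longrightarrow> x \<in> interior K \<Longrightarrow> v x = p K x"
    using shape_functions[OF v] by blast
  have "v x = 0" if K: "K \<in> \<T>" and x: "x \<in> interior K" for K x
  proof -
    have "continuous_on (interior K) (p K)"
      using p(1)[OF K] continuous_on_subset interior_subset by blast
    then have "open (interior K \<inter> p K -` (- {0}))"
      by (intro continuous_open_preimage) auto
    moreover have "negligible (interior K \<inter> p K -` (- {0}))"
      by (rule negligible_subset[OF ae]) (use p(2)[OF K] element[OF K] in auto)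
    ultimately have "interior K \<inter> p K -` (- {0}) = {}"
      using open_not_negligible by blast
    then show ?thesis using p(2)[OF K x] x by auto
  qed
  then show ?thesis using V_eqI[OF v subspace_0[OF subspace_V]] by simp
qed

sublocale finite_dim_inner_product V "l2_inner \<Omega>"
proof
  show "subspace V" by (rule subspace_V)
  show "\<exists>G. finite G \<and> V \<subseteq> span G" by (rule finite_dim_V)
  show "l2_inner \<Omega> (u + v) w = l2_inner \<Omega> u w + l2_inner \<Omega> v w"
    if "u \<in> V" "v \<in> V" "w \<in> V" for u v w
    using that by (simp add: l2_inner_def distrib_right integrable_product)
  show "l2_inner \<Omega> (c *\<^sub>R u) w = c * l2_inner \<Omega> u w" for c u w
    by (simp add: l2_inner_def scaleR_fun_def mult.assoc)
  show "l2_inner \<Omega> u w = l2_inner \<Omega> w u" for u w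
    by (simp add: l2_inner_def mult.commute)
  show "l2_inner \<Omega> u u > 0" if "u \<in> V" "u \<noteq> 0" for u
  proof -
    have "l2_inner \<Omega> u u \<ge> 0" unfolding l2_inner_def by (rule Bochner_Integration.integral_nonneg) simp
    moreover have "l2_inner \<Omega> u u \<noteq> 0" using l2_inner_definite that by blast
    ultimately show ?thesis by simp
  qed
qed

lemma nrm_eq_l2_norm: "nrm = l2_norm \<Omega>"
  by (simp add: fun_eq_iff nrm_def l2_norm_eq)

lemma elem_value_shape:
  assumes "v \<in> V" "K \<in> \<T>"
  shows "\<exists>p\<in>S K. (\<forall>x\<in>interior K. v x = p x) \<and> (\<forall>x\<in>K. elem_value K v x = p x)"
proof -
  obtain p where p: "p \<in> S K" "\<And>x. x \<in> interior K \<Longrightarrow> v x = p x"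
    using shape_function[OF assms] by blast
  have "continuous_on K p" using p(1) shape[OF assms(2)] by (simp add: shape_space_def)
  then have "elem_value K v x = p x" if "x \<in> K" for x
    using elem_value_eq[OF element(2)[OF assms(2)] that] p(2) by blast
  then show ?thesis using p by (intro bexI[of _ p]) auto
qed

lemma elem_value_add:
  assumes "u \<in> V" "v \<in> V" "K \<in> \<T>" "x \<in> K"
  shows "elem_value K (u + v) x = elem_value K u x + elem_value K v x"
proof -
  obtain p where p: "p \<in> S K" "\<And>y. y \<in> interior K \<Longrightarrow> u y = p y" "elem_value K u x = p x"
    using elem_value_shape[OF assms(1,3)] assms(4) by blast
  obtain q where q: "q \<in> S K" "\<And>y. y \<in> interior K \<Longrightarrow> v y = q y" "elem_value K v x = q x"
    using elem_value_shape[OF assms(2,3)] assms(4) by blast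
  have "continuous_on K p" "continuous_on K q"
    using p(1) q(1) shape[OF assms(3)] by (auto simp: shape_space_def)
  then have "elem_value K (u + v) x = p x + q x"
    using p(2) q(2)
    by (intro elem_value_eq[OF element(2)[OF assms(3)] assms(4)] continuous_on_add) auto
  then show ?thesis by (simp add: p(3) q(3))
qed

lemma elem_value_scale:
  assumes "u \<in> V" "K \<in> \<T>" "x \<in> K"
  shows "elem_value K (c *\<^sub>R u) x = c * elem_value K u x"
proof -
  obtain p where p: "p \<in> S K" "\<And>y. y \<in> interior K \<Longrightarrow> u y = p y" "elem_value K u x = p x"
    using elem_value_shape[OF assms(1,2)] assms(3) by blast
  have "continuous_on K p"
    using p(1) shape[OF assms(2)] by (auto simp: shape_space_def)
  then have "elem_value K (c *\<^sub>R u) x = c * p x"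
    using p(2) by (intro elem_value_eq[OF element(2)[OF assms(2)] assms(3)] continuous_on_mult_left)
      (auto simp: scaleR_fun_def)
  then show ?thesis by (simp add: p(3))
qed

end

section \<open>Interpolation and averaging of degrees of freedom\<close>

locale lagrange_finite_element_space = broken_finite_element_space \<Omega> \<T> S
  for \<Omega> :: "'a::euclidean_space set" and \<T> :: "'a set set" and S +
  fixes N :: "'a set \<Rightarrow> 'a set" and D :: "('a set \<times> 'a) set set"
  assumes lagrange: "K \<in> \<T> \<Longrightarrow> lagrange_element K (S K) (N K)"
    and dofs: "dof_identification \<T> N D"
begin

abbreviation "V\<^sub>c \<equiv> conforming_space \<T> S D"

lemma node_in_element: "K \<in> \<T> \<Longrightarrow> x \<in> N K \<Longrightarrow> x \<in> K"
  using lagrange[of K] by (auto simp: lagrange_element_def)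

text \<open>Uniqueness in unisolvence, element by element.\<close>

lemma nodal_determines:
  assumes "u \<in> V" "v \<in> V"
    and eq: "\<And>K x. K \<in> \<T> \<Longrightarrow> x \<in> N K \<Longrightarrow> elem_value K u x = elem_value K v x"
  shows "u = v"
proof (rule V_eqI[OF assms(1,2)])
  fix K x assume K: "K \<in> \<T>" and x: "x \<in> interior K"
  obtain p where p: "p \<in> S K" "\<And>y. y \<in> interior K \<Longrightarrow> u y = p y"
    "\<And>y. y \<in> K \<Longrightarrow> elem_value K u y = p y"
    using elem_value_shape[OF assms(1) K] by blast
  obtain q where q: "q \<in> S K" "\<And>y. y \<in> interior K \<Longrightarrow> v y = q y"
    "\<And>y. y \<in> K \<Longrightarrow> elem_value K v y = q y"
    using elem_value_shape[OF assms(2) K] by blast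
  have "\<forall>y\<in>N K. p y = q y" using eq[OF K] node_in_element[OF K] p(3) q(3) by auto
  then have "\<forall>y\<in>K. p y = q y"
    using lagrange[OF K] p(1) q(1) by (simp add: lagrange_element_def)
  then show "u x = v x" using p(2)[OF x] q(2)[OF x] x interior_subset by auto
qed

text \<open>Existence in unisolvence, element by element: a broken function may take independent
  values at the nodes of different elements, even where these coincide.\<close>

lemma nodal_existence:
  "\<exists>u\<in>V. \<forall>K\<in>\<T>. \<forall>x\<in>N K. elem_value K u x = y K x"
proof -
  have "\<forall>K\<in>\<T>. \<exists>p. p \<in> S K \<and> (\<forall>x\<in>N K. p x = y K x)"
  proof
    fix K assume "K \<in> \<T>"
    then have "\<forall>z. \<exists>p\<in>S K. \<forall>x\<in>N K. p x = z x"
      using lagrange[of K] by (simp add: lagrange_element_def)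
    then show "\<exists>p. p \<in> S K \<and> (\<forall>x\<in>N K. p x = y K x)" by blast
  qed
  from bchoice[OF this] obtain p where p: "\<And>K. K \<in> \<T> \<Longrightarrow> p K \<in> S K"
    "\<And>K x. K \<in> \<T> \<Longrightarrow> x \<in> N K \<Longrightarrow> p K x = y K x" by auto
  have "elem_value K (\<lambda>x. \<Sum>L\<in>\<T>. cut L (p L) x) x = y K x" if "K \<in> \<T>" "x \<in> N K" for K x
  proof -
    have "continuous_on K (p K)" using p(1) shape that by (auto simp: shape_space_def)
    then have "elem_value K (\<lambda>x. \<Sum>L\<in>\<T>. cut L (p L) x) x = p K x"
      using elem_value_eq[OF element(2) node_in_element] sum_cut that by simp
    then show ?thesis using p(2) that by simp
  qed
  then show ?thesis by (intro bexI[OF _ glued_in_V[of p]] p(1)) auto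
qed

lemma block_node: "\<sigma> \<in> D \<Longrightarrow> (K, x) \<in> \<sigma> \<Longrightarrow> K \<in> \<T> \<and> x \<in> N K \<and> x \<in> K"
  using dofs node_in_element[of K x] unfolding dof_identification_def partition_on_def by blast

lemma node_block:
  assumes "K \<in> \<T>" "x \<in> N K"
  shows "\<exists>\<sigma>\<in>D. (K, x) \<in> \<sigma>"
proof -
  have "(K, x) \<in> \<Union>D"
    using dofs assms partition_onD1[of "Sigma \<T> N" D] unfolding dof_identification_def by blast
  then show ?thesis by blast
qed

lemma block_unique: "\<lbrakk>\<sigma> \<in> D; \<tau> \<in> D; (K, x) \<in> \<sigma>; (K, x) \<in> \<tau>\<rbrakk> \<Longrightarrow> \<sigma> = \<tau>"
  using dofs unfolding dof_identification_def partition_on_def disjoint_def by blast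

lemma conforming_subset: "V\<^sub>c \<subseteq> V"
  by (auto simp: conforming_space_def)

text \<open>Instead of comparing pairs of values in a block, name their common value \<open>m \<sigma>\<close>. In this form
  the condition is visibly linear, and the values can be prescribed.\<close>

lemma conforming_iff:
  "u \<in> V\<^sub>c \<longleftrightarrow> u \<in> V \<and> (\<exists>m. \<forall>\<sigma>\<in>D. \<forall>(K, x)\<in>\<sigma>. elem_value K u x = m \<sigma>)"
proof
  assume u: "u \<in> V\<^sub>c"
  have "elem_value K u x = (case SOME d. d \<in> \<sigma> of (L, y) \<Rightarrow> elem_value L u y)"
    if "\<sigma> \<in> D" "(K, x) \<in> \<sigma>" for \<sigma> K x
  proof -
    have "(SOME d. d \<in> \<sigma>) \<in> \<sigma>" using that(2) by (rule someI)
    then show ?thesis using u that unfolding conforming_space_def by fastforce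
  qed
  then show "u \<in> V \<and> (\<exists>m. \<forall>\<sigma>\<in>D. \<forall>(K, x)\<in>\<sigma>. elem_value K u x = m \<sigma>)"
    using u conforming_subset
    by (intro conjI exI[of _ "\<lambda>\<sigma>. case SOME d. d \<in> \<sigma> of (L, y) \<Rightarrow> elem_value L u y"]) auto
next
  assume "u \<in> V \<and> (\<exists>m. \<forall>\<sigma>\<in>D. \<forall>(K, x)\<in>\<sigma>. elem_value K u x = m \<sigma>)"
  then obtain m where "u \<in> V" "\<And>\<sigma> K x. \<sigma> \<in> D \<Longrightarrow> (K, x) \<in> \<sigma> \<Longrightarrow> elem_value K u x = m \<sigma>"
    by blast
  then show "u \<in> V\<^sub>c" by (auto simp: conforming_space_def)
qed

lemma subspace_conforming: "subspace V\<^sub>c"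
proof (rule subspaceI)
  have zero: "elem_value K 0 x = 0" if "K \<in> \<T>" "x \<in> K" for K x
    using elem_value_scale[OF subspace_0[OF subspace_V] that, of 0] by simp
  show "0 \<in> V\<^sub>c"
    unfolding conforming_iff using zero block_node subspace_0[OF subspace_V]
    by (intro conjI exI[of _ "\<lambda>_. 0"]) auto
  fix u assume "u \<in> V\<^sub>c"
  then obtain m where u: "u \<in> V" "\<And>\<sigma> K x. \<sigma> \<in> D \<Longrightarrow> (K, x) \<in> \<sigma> \<Longrightarrow> elem_value K u x = m \<sigma>"
    unfolding conforming_iff by blast
  show "c *\<^sub>R u \<in> V\<^sub>c" for c
    unfolding conforming_iff using u block_node subspace_scale[OF subspace_V u(1)]
    by (intro conjI exI[of _ "\<lambda>\<sigma>. c * m \<sigma>"]) (auto simp: elem_value_scale)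
  fix v assume "v \<in> V\<^sub>c"
  then obtain n where v: "v \<in> V" "\<And>\<sigma> K x. \<sigma> \<in> D \<Longrightarrow> (K, x) \<in> \<sigma> \<Longrightarrow> elem_value K v x = n \<sigma>"
    unfolding conforming_iff by blast
  show "u + v \<in> V\<^sub>c"
    unfolding conforming_iff using u v block_node subspace_add[OF subspace_V u(1) v(1)]
    by (intro conjI exI[of _ "\<lambda>\<sigma>. m \<sigma> + n \<sigma>"]) (auto simp: elem_value_add)
qed

text \<open>The blocks partition the local degrees of freedom, so one value for each block amounts to
  one value for each node of each element, and unisolvence applies. The resulting broken function
  is conforming because the prescribed values are constant on the blocks.\<close>

lemma averaging_ex1:
  "\<exists>!u. u \<in> V\<^sub>c \<and> (\<forall>\<sigma>\<in>D. \<forall>(K, x)\<in>\<sigma>. elem_value K u x = m \<sigma>)"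
proof -
  define y where "y K x = m (THE \<sigma>. \<sigma> \<in> D \<and> (K, x) \<in> \<sigma>)" for K x
  obtain u where u: "u \<in> V" "\<And>K x. K \<in> \<T> \<Longrightarrow> x \<in> N K \<Longrightarrow> elem_value K u x = y K x"
    using nodal_existence[of y] by blast
  have um: "elem_value K u x = m \<sigma>" if "\<sigma> \<in> D" "(K, x) \<in> \<sigma>" for \<sigma> K x
  proof -
    have "(THE \<tau>. \<tau> \<in> D \<and> (K, x) \<in> \<tau>) = \<sigma>"
      using that block_unique by (intro the_equality) auto
    then show ?thesis using u(2) block_node[OF that] by (simp add: y_def)
  qed
  show ?thesis
  proof (rule ex1I[of _ u])
    show "u \<in> V\<^sub>c \<and> (\<forall>\<sigma>\<in>D. \<forall>(K, x)\<in>\<sigma>. elem_value K u x = m \<sigma>)"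
      using u(1) um unfolding conforming_iff by blast
    fix w assume w: "w \<in> V\<^sub>c \<and> (\<forall>\<sigma>\<in>D. \<forall>(K, x)\<in>\<sigma>. elem_value K w x = m \<sigma>)"
    show "w = u"
    proof (rule nodal_determines)
      show "w \<in> V" "u \<in> V" using w u(1) conforming_subset by auto
      fix K x assume "K \<in> \<T>" "x \<in> N K"
      then obtain \<sigma> where "\<sigma> \<in> D" "(K, x) \<in> \<sigma>" using node_block by blast
      then show "elem_value K w x = elem_value K u x" using w um by fastforce
    qed
  qed
qed

text \<open>The source \<open>U\<close> is any space on which evaluation from within an element is linear; the
  use below is the broken space of higher degree, whose shape functions are not those of \<open>V\<close>.\<close>

lemma linear_nodal_interpolation:
  assumes U: "subspace U"
    and add: "\<And>u v K x. \<lbrakk>u \<in> U; v \<in> U; K \<in> \<T>; x \<in> K\<rbrakk>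
      \<Longrightarrow> elem_value K (u + v) x = elem_value K u x + elem_value K v x"
    and scale: "\<And>c u K x. \<lbrakk>u \<in> U; K \<in> \<T>; x \<in> K\<rbrakk>
      \<Longrightarrow> elem_value K (c *\<^sub>R u) x = c * elem_value K u x"
  shows "linear_between U V (nodal_interpolation \<T> N V)"
  unfolding nodal_interpolation_def
proof (rule linear_between_The[OF U])
  fix v assume "v \<in> U"
  obtain u where u: "u \<in> V" "\<forall>K\<in>\<T>. \<forall>x\<in>N K. elem_value K u x = elem_value K v x"
    using nodal_existence[of "\<lambda>K. elem_value K v"] by blast
  then show "\<exists>!u. u \<in> V \<and> (\<forall>K\<in>\<T>. \<forall>x\<in>N K. elem_value K u x = elem_value K v x)"
    by (intro ex1I[of _ u] conjI nodal_determines) auto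
next
  fix v v' u u' assume "v \<in> U" "v' \<in> U" "u \<in> V" "u' \<in> V"
    "\<forall>K\<in>\<T>. \<forall>x\<in>N K. elem_value K u x = elem_value K v x"
    "\<forall>K\<in>\<T>. \<forall>x\<in>N K. elem_value K u' x = elem_value K v' x"
  then show "u + u' \<in> V \<and>
    (\<forall>K\<in>\<T>. \<forall>x\<in>N K. elem_value K (u + u') x = elem_value K (v + v') x)"
    by (simp add: add elem_value_add node_in_element subspace_add[OF subspace_V])
next
  fix v u c assume "v \<in> U" "u \<in> V" "\<forall>K\<in>\<T>. \<forall>x\<in>N K. elem_value K u x = elem_value K v x"
  then show "c *\<^sub>R u \<in> V \<and>
    (\<forall>K\<in>\<T>. \<forall>x\<in>N K. elem_value K (c *\<^sub>R u) x = elem_value K (c *\<^sub>R v) x)"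
    by (simp add: scale elem_value_scale node_in_element subspace_scale[OF subspace_V])
qed

lemma linear_dof_averaging: "linear_between V V\<^sub>c (dof_averaging D V\<^sub>c)"
proof -
  let ?m = "\<lambda>v \<sigma>. (\<Sum>(L, y)\<in>\<sigma>. elem_value L v y) / real (card \<sigma>)"
  have m_add: "?m (v + w) \<sigma> = ?m v \<sigma> + ?m w \<sigma>" if "v \<in> V" "w \<in> V" "\<sigma> \<in> D" for v w \<sigma>
  proof -
    have "(\<Sum>(L, y)\<in>\<sigma>. elem_value L (v + w) y)
        = (\<Sum>(L, y)\<in>\<sigma>. elem_value L v y + elem_value L w y)"
      using that block_node by (intro sum.cong) (auto simp: elem_value_add)
    then show ?thesis by (simp add: case_prod_beta sum.distrib add_divide_distrib)
  qed
  have m_scale: "?m (c *\<^sub>R v) \<sigma> = c * ?m v \<sigma>" if "v \<in> V" "\<sigma> \<in> D" for c v \<sigma>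
  proof -
    have "(\<Sum>(L, y)\<in>\<sigma>. elem_value L (c *\<^sub>R v) y) = (\<Sum>(L, y)\<in>\<sigma>. c * elem_value L v y)"
      using that block_node by (intro sum.cong) (auto simp: elem_value_scale)
    then show ?thesis by (simp add: case_prod_beta flip: sum_distrib_left)
  qed
  show ?thesis
    unfolding dof_averaging_def
  proof (rule linear_between_The[OF subspace_V])
    show "\<exists>!u. u \<in> V\<^sub>c \<and> (\<forall>\<sigma>\<in>D. \<forall>(K, x)\<in>\<sigma>. elem_value K u x = ?m v \<sigma>)" for v
      by (rule averaging_ex1)
  next
    fix v v' u u' assume v: "v \<in> V" "v' \<in> V" and u: "u \<in> V\<^sub>c" "u' \<in> V\<^sub>c"
      and eq: "\<forall>\<sigma>\<in>D. \<forall>(K, x)\<in>\<sigma>. elem_value K u x = ?m v \<sigma>"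
        "\<forall>\<sigma>\<in>D. \<forall>(K, x)\<in>\<sigma>. elem_value K u' x = ?m v' \<sigma>"
    have "elem_value K (u + u') x = ?m (v + v') \<sigma>" if "\<sigma> \<in> D" "(K, x) \<in> \<sigma>" for \<sigma> K x
    proof -
      have "u \<in> V" "u' \<in> V" using u conforming_subset by auto
      then have sum: "elem_value K (u + u') x = elem_value K u x + elem_value K u' x"
        using block_node[OF that] by (simp add: elem_value_add)
      have "elem_value K u x = ?m v \<sigma>" "elem_value K u' x = ?m v' \<sigma>" using eq that by blast+
      then show ?thesis by (simp only: sum m_add[OF v that(1)])
    qed
    then show "u + u' \<in> V\<^sub>c \<and> (\<forall>\<sigma>\<in>D. \<forall>(K, x)\<in>\<sigma>. elem_value K (u + u') x = ?m (v + v') \<sigma>)"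
      using subspace_add[OF subspace_conforming u] by blast
  next
    fix v u c assume v: "v \<in> V" and u: "u \<in> V\<^sub>c"
      and eq: "\<forall>\<sigma>\<in>D. \<forall>(K, x)\<in>\<sigma>. elem_value K u x = ?m v \<sigma>"
    have "elem_value K (c *\<^sub>R u) x = ?m (c *\<^sub>R v) \<sigma>" if "\<sigma> \<in> D" "(K, x) \<in> \<sigma>" for \<sigma> K x
    proof -
      have "u \<in> V" using u conforming_subset by auto
      then have mult: "elem_value K (c *\<^sub>R u) x = c * elem_value K u x"
        using block_node[OF that] by (simp add: elem_value_scale)
      have "elem_value K u x = ?m v \<sigma>" using eq that by blast
      then show ?thesis by (simp only: mult m_scale[OF v that(1)])
    qed
    then show "c *\<^sub>R u \<in> V\<^sub>c \<and> (\<forall>\<sigma>\<in>D. \<forall>(K, x)\<in>\<sigma>. elem_value K (c *\<^sub>R u) x = ?m (c *\<^sub>R v) \<sigma>)"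
      using subspace_scale[OF subspace_conforming u, of c] by (simp add: case_prod_beta)
  qed
qed

end

section \<open>Stability of the recovered scheme\<close>

theorem theorem2:
  fixes \<Omega> :: "'a::euclidean_space set"
    and \<T> :: "'a set set"
    and S0 S1 :: "'a set \<Rightarrow> ('a \<Rightarrow> real) set"
    and N :: "'a set \<Rightarrow> 'a set"
    and D :: "('a set \<times> 'a) set set"
    and V0 V0hat V1 V1tilde :: "('a \<Rightarrow> real) set"
    and R P :: "('a \<Rightarrow> real) \<Rightarrow> ('a \<Rightarrow> real)"
  assumes mesh: "mesh \<Omega> \<T>"
    and elements0: "\<And>K. K \<in> \<T> \<Longrightarrow> lagrange_element K (S0 K) (N K)"
    and elements1: "\<And>K. K \<in> \<T> \<Longrightarrow> shape_space K (S1 K)"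
    and dofs: "dof_identification \<T> N D"
    and V0: "V0 = conforming_space \<T> S0 D"
    and V0hat: "V0hat = broken_space \<T> S0"
    and V1: "V1 = broken_space \<T> S1"
    and V1tilde: "V1tilde = continuous_subspace \<Omega> \<T> V1"
    and sub: "V0hat \<subseteq> V1"
    and R: "R \<in> V0 \<rightarrow> V1tilde"
    and R_bound: "\<exists>C>0. \<forall>\<rho>\<in>V0. l2_norm \<Omega> (R \<rho>) \<le> C * l2_norm \<Omega> \<rho>"
    and P: "P = l2_projection \<Omega> V0 \<or>
            P = dof_averaging D V0 \<circ> nodal_interpolation \<T> N V0hat"
  shows "\<exists>\<kappa>::real. \<forall>A \<in> V1 \<rightarrow> V1. \<forall>\<alpha>::real.
           l2_opnorm \<Omega> V1 A \<le> ereal \<alpha> \<longrightarrow>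
           l2_opnorm \<Omega> V0 (recovered_step P A (l2_projection \<Omega> V0hat) R) \<le> ereal (\<kappa> * \<alpha>)"
proof -
  interpret hi: broken_finite_element_space \<Omega> \<T> S1
    using mesh elements1 by unfold_locales
  interpret lo: lagrange_finite_element_space \<Omega> \<T> S0 N D
    using mesh elements0 dofs by unfold_locales (auto simp: lagrange_element_def)
  have norm: "hi.nrm = l2_norm \<Omega>" by (rule hi.nrm_eq_l2_norm)
  have V0_sub: "subspace V0" "V0 \<subseteq> V0hat"
    using lo.subspace_conforming lo.conforming_subset by (simp_all add: V0 V0hat)
  have V0hat_sub: "subspace V0hat" using lo.subspace_V by (simp add: V0hat)
  have V1_sub: "subspace V1" using hi.subspace_V by (simp add: V1)
  let ?Q = "l2_projection \<Omega> V0hat"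
  have projection: "linear_between V1 U (l2_projection \<Omega> U)" if "subspace U" "U \<subseteq> V1" for U
    using hi.linear_between_projection that unfolding V1 l2_projection_def by blast
  have "linear_between V1 V0 P"
    using P
  proof
    assume "P = l2_projection \<Omega> V0"
    then show ?thesis using projection V0_sub sub by auto
  next
    assume P: "P = dof_averaging D V0 \<circ> nodal_interpolation \<T> N V0hat"
    have "linear_between V1 V0hat (nodal_interpolation \<T> N V0hat)"
      unfolding V0hat V1
      using hi.subspace_V hi.elem_value_add hi.elem_value_scale
      by (rule lo.linear_nodal_interpolation)
    moreover have "linear_between V0hat V0 (dof_averaging D V0)"
      unfolding V0 V0hat by (rule lo.linear_dof_averaging)
    ultimately show ?thesis unfolding P by (rule linear_between_comp)
  qed
  then have "linear_between V1 V1 P"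
    by (rule linear_between_mono) (use V0_sub(2) sub in auto)
  then obtain CP where CP: "CP \<ge> 0" "\<And>v. v \<in> V1 \<Longrightarrow> l2_norm \<Omega> (P v) \<le> CP * l2_norm \<Omega> v"
    using hi.linear_bounded[of P] unfolding norm V1 by blast
  have Q: "linear_between V1 V0hat ?Q" by (rule projection[OF V0hat_sub sub])
  then have "linear_between V1 V1 ?Q" using sub by (rule linear_between_mono)
  then obtain CQ where CQ: "CQ \<ge> 0" "\<And>v. v \<in> V1 \<Longrightarrow> l2_norm \<Omega> (?Q v) \<le> CQ * l2_norm \<Omega> v"
    using hi.linear_bounded[of ?Q] unfolding norm V1 by blast
  have Q_id: "?Q v = v" if "v \<in> V0hat" for v
  proof -
    have "\<exists>!p. p \<in> V0hat \<and> (\<forall>\<psi>\<in>V0hat. l2_inner \<Omega> \<psi> p = l2_inner \<Omega> \<psi> v)"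
      using hi.projection_ex1[OF V0hat_sub] sub that unfolding V1 by blast
    then show ?thesis unfolding l2_projection_def by (rule the1_equality) (use that in auto)
  qed
  obtain C where C: "C > 0" "\<And>\<rho>. \<rho> \<in> V0 \<Longrightarrow> l2_norm \<Omega> (R \<rho>) \<le> C * l2_norm \<Omega> \<rho>"
    using R_bound by blast
  define B where "B = C + CQ * C + 1"
  show ?thesis
  proof (intro exI[of _ "CP * B"] ballI allI impI)
    fix A \<alpha> assume A: "A \<in> V1 \<rightarrow> V1" and A_bound: "l2_opnorm \<Omega> V1 A \<le> ereal \<alpha>"
    have step: "l2_norm \<Omega> (recovered_step P A ?Q R \<rho>) / l2_norm \<Omega> \<rho> \<le> CP * B * \<alpha>"
      if \<rho>: "\<rho> \<in> V0" and pos: "l2_norm \<Omega> \<rho> > 0" for \<rho>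
    proof -
      define w where "w = R \<rho> - ?Q (R \<rho>) + \<rho>"
      have \<rho>V: "\<rho> \<in> V0hat" "\<rho> \<in> V1" using \<rho> V0_sub sub by auto
      have RV: "R \<rho> \<in> V1" using R \<rho> by (auto simp: V1tilde continuous_subspace_def)
      have QV: "?Q (R \<rho>) \<in> V0hat" using Q RV by (auto simp: linear_between_def)
      then have QV1: "- ?Q (R \<rho>) \<in> V1" using sub subspace_neg[OF V1_sub] by auto
      have w: "w \<in> V1"
        unfolding w_def using RV QV \<rho>V sub V1_sub by (intro subspace_add subspace_diff) auto
      \<comment> \<open>The bound on \<open>A\<close> does not cover the value of \<open>A\<close> at zero.\<close>
      have "w \<noteq> 0"
      proof
        assume "w = 0"
        then have Req: "R \<rho> = ?Q (R \<rho>) - \<rho>"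
          by (simp add: w_def algebra_simps eq_diff_eq)
        then have "R \<rho> \<in> V0hat" using subspace_diff[OF V0hat_sub QV \<rho>V(1)] by simp
        then have "\<rho> = 0" using Q_id Req by simp
        then show False using pos by (simp add: l2_norm_def)
      qed
      then have w_pos: "l2_norm \<Omega> w > 0" using hi.nrm_pos w unfolding norm V1 by blast
      have "l2_norm \<Omega> w \<le> l2_norm \<Omega> (R \<rho>) + l2_norm \<Omega> (?Q (R \<rho>)) + l2_norm \<Omega> \<rho>"
      proof -
        have "l2_norm \<Omega> w \<le> l2_norm \<Omega> (R \<rho> + - ?Q (R \<rho>)) + l2_norm \<Omega> \<rho>"
          using hi.nrm_triangle[of "R \<rho> + - ?Q (R \<rho>)" \<rho>] subspace_add[OF V1_sub RV QV1] \<rho>V(2)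
          unfolding norm V1 w_def by simp
        also have "l2_norm \<Omega> (R \<rho> + - ?Q (R \<rho>)) \<le> l2_norm \<Omega> (R \<rho>) + l2_norm \<Omega> (- ?Q (R \<rho>))"
          using hi.nrm_triangle RV QV1 unfolding norm V1 by blast
        also have "l2_norm \<Omega> (- ?Q (R \<rho>)) = l2_norm \<Omega> (?Q (R \<rho>))" by (simp add: l2_norm_def)
        finally show ?thesis by simp
      qed
      also have "l2_norm \<Omega> (?Q (R \<rho>)) \<le> CQ * l2_norm \<Omega> (R \<rho>)" by (rule CQ(2)[OF RV])
      also have "CQ * l2_norm \<Omega> (R \<rho>) \<le> CQ * (C * l2_norm \<Omega> \<rho>)"
        by (rule mult_left_mono[OF C(2)[OF \<rho>] CQ(1)])
      also have "l2_norm \<Omega> (R \<rho>) \<le> C * l2_norm \<Omega> \<rho>" by (rule C(2)[OF \<rho>])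
      finally have w_le: "l2_norm \<Omega> w \<le> B * l2_norm \<Omega> \<rho>" by (simp add: B_def algebra_simps)
      have "ereal (l2_norm \<Omega> (A w) / l2_norm \<Omega> w) \<le> ereal \<alpha>"
        by (rule order.trans[OF _ A_bound], unfold l2_opnorm_def, rule SUP_upper)
          (use w w_pos in auto)
      then have Aw: "l2_norm \<Omega> (A w) \<le> \<alpha> * l2_norm \<Omega> w" using w_pos by (simp add: field_simps)
      \<comment> \<open>Needed to multiply the bound on \<open>w\<close> by \<open>\<alpha>\<close>; a negative \<open>\<alpha>\<close> cannot bound a quotient of norms.\<close>
      have "0 \<le> \<alpha> * l2_norm \<Omega> w" by (rule order.trans[OF _ Aw]) (simp add: l2_norm_def)
      then have "\<alpha> \<ge> 0" using w_pos by (simp add: zero_le_mult_iff)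
      have "l2_norm \<Omega> (P (A w)) \<le> CP * l2_norm \<Omega> (A w)" using CP(2) A w by blast
      also have "\<dots> \<le> CP * (\<alpha> * l2_norm \<Omega> w)" by (rule mult_left_mono[OF Aw CP(1)])
      also have "\<dots> \<le> CP * (\<alpha> * (B * l2_norm \<Omega> \<rho>))"
        by (intro mult_left_mono w_le CP(1) \<open>\<alpha> \<ge> 0\<close>)
      finally have "l2_norm \<Omega> (P (A w)) \<le> CP * (\<alpha> * (B * l2_norm \<Omega> \<rho>))" .
      moreover have "recovered_step P A ?Q R \<rho> = P (A w)"
        by (simp add: recovered_step_def w_def plus_fun_def fun_diff_def)
      ultimately show ?thesis using pos by (simp add: field_simps)
    qed
    show "l2_opnorm \<Omega> V0 (recovered_step P A ?Q R) \<le> ereal (CP * B * \<alpha>)"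
      unfolding l2_opnorm_def by (rule SUP_least) (use step in auto)
  qed
qed

end
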